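(* For all $n,k\in\mathbb{Z}_{\ge 0}$ and all $x>0$, $$\Delta_k^{(n)}(x)=\binom{n}{k}\frac{Q_k(x)}{x^{k-1}}.$$
   Context: The integers $\Omega(a,b)$, for $a\in\mathbb{Z}_{>0}$ and $b\in\mathbb{Z}_{\ge 0}$, are defined recursively by: $\Omega(a,0)=1$; $\Omega(a,b)=0$ if $b\ge a$ and $b\ge 1$; $\Omega(a,1)=\Omega(a-1,1)+1$ for $a\ge 2$; and $\Omega(a,b)=\Omega(a-1,b)-(b-1)\,\Omega(a-1,b-1)$ for $2\le b\le a-1$. For $n,k\in\mathbb{Z}_{\ge 0}$ and real $x>0$, the functions $\Delta_k^{(n)}(x)$ are defined recursively by: $\Delta_0^{(n)}(x)=1$; for $1\le k\le n$, $$\Delta_k^{(n)}(x)=\Delta_k^{(n-1)}(x)+\sum_{i=0}^{k-1}\Omega(n,i)\frac{1}{x^i}\Delta_{k-1-i}^{(n-1-i)}(x);$$ and $\Delta_k^{(n)}(x)=0$ if $k>n$. The superscript $(n)$ is an index, not a derivative. The functions $Q_k$ are defined by $Q_0(x)=\frac{1}{x}$ and $Q_k(x)=x\sum_{i=0}^{k-1}\Omega(k,i)\,Q_{k-1-i}(x)$ for $k=1,2,\dots$. The binomial coefficient $\binom{n}{k}$ is $0$ for $k>n$. *)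

theory Defs
  imports Complex_Main
begin

(* The paper has a > 0; the values for a = 0, obtained here by applying the first two
   clauses also to a = 0, are not used by Delta and Q below. *)
function Omega :: "nat \<Rightarrow> nat \<Rightarrow> int" where
  "Omega a b =
     (if b = 0 then 1
      else if a \<le> b then 0
      else if b = 1 then Omega (a - 1) 1 + 1
      else Omega (a - 1) b - (int b - 1) * Omega (a - 1) (b - 1))"
  by pat_completeness auto
termination by (relation "measure fst") auto

declare Omega.simps [simp del]

(* Delta n k x is \<Delta>_k^{(n)}(x): the superscript is the first argument. In the last
   clause 1 \<le> k \<le> n and i < k, so the natural-number subtractions do not truncate. *)
function Delta :: "nat \<Rightarrow> nat \<Rightarrow> real \<Rightarrow> real" where
  "Delta n k x =
     (if k = 0 then 1
      else if n < k then 0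
      else Delta (n - 1) k x
           + (\<Sum>i<k. of_int (Omega n i) * (1 / x ^ i) * Delta (n - 1 - i) (k - 1 - i) x))"
  by pat_completeness auto
termination by (relation "measure fst") auto

declare Delta.simps [simp del]

function Q :: "nat \<Rightarrow> real \<Rightarrow> real" where
  "Q k x =
     (if k = 0 then 1 / x
      else x * (\<Sum>i<k. of_int (Omega k i) * Q (k - 1 - i) x))"
  by pat_completeness auto
termination by (relation "measure fst") auto

declare Q.simps [simp del]

end

theory Submission
  imports Defs
begin

text \<open>
  The integers \<open>\<Omega>(a, b)\<close> have a closed form: for fixed \<open>b\<close> they are a constant
  times \<open>a - 1 choose b\<close>, since the recursion in \<open>a\<close> is Pascal's rule up to the factor
  \<open>-(b - 1)\<close>, which the constant absorbs (\<open>Omega_Suc_eq\<close>). Hence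
  \<open>\<Omega>(n, i)\<close> and \<open>\<Omega>(k, i)\<close> differ only in the binomial coefficient, and the trinomial
  revision \<open>(n-1 choose i) (n-1-i choose k-1-i) = (n-1 choose k-1) (k-1 choose i)\<close>
  trades the one for the other (\<open>Omega_mult_choose\<close>).

  The quotients \<open>q\<^sub>k = Q\<^sub>k / x\<^bsup>k-1\<^esup>\<close> satisfy
  \<open>q\<^sub>k = (\<Sum>i<k. \<Omega>(k, i) x\<^bsup>-i\<^esup> q\<^bsub>k-1-i\<^esub>)\<close> (\<open>normalized_Q_Suc\<close>). By induction on \<open>n\<close>, the
  sum in the recursion for \<open>\<Delta>\<close> therefore equals \<open>(n-1 choose k-1) q\<^sub>k\<close>, term by term,
  and adding \<open>(n-1 choose k) q\<^sub>k\<close> gives \<open>(n choose k) q\<^sub>k\<close> by Pascal's rule.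
\<close>

text \<open>
  The recursion requires the constant \<open>c\<^sub>b\<close> of the closed form to satisfy
  \<open>c\<^sub>b = -(b - 1) c\<^bsub>b-1\<^esub>\<close> for \<open>b \<ge> 2\<close> and \<open>c\<^sub>1 = c\<^sub>0 = 1\<close>, which makes it a signed factorial.
\<close>

definition Omega_coeff :: "nat \<Rightarrow> int" where
  "Omega_coeff b = (if b = 0 then 1 else (- 1) ^ (b - 1) * fact (b - 1))"

lemma Omega_coeff_Suc:
  assumes "b \<ge> 1"
  shows "Omega_coeff (Suc b) = - int b * Omega_coeff b"
  using assms by (cases b) (simp_all add: Omega_coeff_def algebra_simps)

lemma Omega_Suc_eq: "Omega (Suc m) b = Omega_coeff b * int (m choose b)"
proof (induction m arbitrary: b)
  case 0
  show ?case
    by (cases b) (simp_all add: Omega.simps[of "Suc 0"] Omega_coeff_def)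
next
  case (Suc m)
  consider "b = 0" | "b = 1" | "b \<ge> 2" "Suc (Suc m) \<le> b" | c where "b = Suc c" "c \<ge> 1" "c \<le> m"
    by (cases b) force+
  then show ?case
  proof cases
    case 1
    then show ?thesis by (simp add: Omega.simps[of _ 0] Omega_coeff_def)
  next
    case 2
    then show ?thesis
      using Suc.IH[of 1] by (simp add: Omega.simps[of "Suc (Suc m)"] Omega_coeff_def)
  next
    case 3
    then show ?thesis by (simp add: Omega.simps[of "Suc (Suc m)"])
  next
    case 4
    have "Omega (Suc (Suc m)) b = Omega (Suc m) (Suc c) - int c * Omega (Suc m) c"
      using 4 by (simp add: Omega.simps[of "Suc (Suc m)"])
    also have "\<dots> = Omega_coeff (Suc c) * int (m choose Suc c) - int c * (Omega_coeff c * int (m choose c))"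
      by (simp only: Suc.IH)
    also have "\<dots> = Omega_coeff b * int (Suc m choose b)"
      using 4 by (simp add: Omega_coeff_Suc algebra_simps)
    finally show ?thesis .
  qed
qed

text \<open>
  By the closed form this is the trinomial revision identity. It is what turns the
  coefficients \<open>\<Omega>(n, i)\<close> of the recursion for \<open>\<Delta>\<close> into the coefficients \<open>\<Omega>(k, i)\<close> of the
  recursion for \<open>Q\<close>.
\<close>

lemma Omega_mult_choose:
  assumes "i \<le> j" "j \<le> m"
  shows "Omega (Suc m) i * int ((m - i) choose (j - i)) = int (m choose j) * Omega (Suc j) i"
proof -
  have "int (m choose i) * int ((m - i) choose (j - i)) = int (m choose j) * int (j choose i)"
    using choose_mult[OF assms] by (metis of_nat_mult)
  then show ?thesis
    by (simp add: Omega_Suc_eq algebra_simps)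
qed

definition normalized_Q :: "nat \<Rightarrow> real \<Rightarrow> real" where
  "normalized_Q k x = Q k x / x powi (int k - 1)"

lemma normalized_Q_0: "x \<noteq> 0 \<Longrightarrow> normalized_Q 0 x = 1"
  by (simp add: normalized_Q_def Q.simps[of 0] power_int_minus)

text \<open>
  The powers of \<open>x\<close> balance: passing from \<open>Q\<^bsub>j-i\<^esub>\<close> to its normalization costs
  \<open>x\<^bsup>j-i-1\<^esup>\<close>, the recursion has a factor \<open>x\<close>, and normalizing \<open>Q\<^bsub>j+1\<^esub>\<close> divides by
  \<open>x\<^sup>j\<close>, leaving \<open>x\<^bsup>-i\<^esup>\<close>.
\<close>

lemma normalized_Q_Suc:
  assumes "x \<noteq> 0"
  shows "normalized_Q (Suc j) x =
    (\<Sum>i<Suc j. of_int (Omega (Suc j) i) * (1 / x ^ i) * normalized_Q (j - i) x)"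
proof -
  have pow: "x * Q (j - i) x / x ^ j = (1 / x ^ i) * normalized_Q (j - i) x" if "i < Suc j" for i
  proof -
    have "x powi (int (j - i) - 1) = x ^ (j - i) / x"
      using assms by (simp add: power_int_diff)
    moreover have "x ^ j = x ^ i * x ^ (j - i)"
      using that by (simp flip: power_add)
    ultimately show ?thesis
      using assms by (simp add: normalized_Q_def)
  qed
  have "normalized_Q (Suc j) x =
      (\<Sum>i<Suc j. of_int (Omega (Suc j) i) * (x * Q (j - i) x / x ^ j))"
    by (simp add: normalized_Q_def Q.simps[of "Suc j"] sum_distrib_left sum_divide_distrib
        mult_ac del: sum.lessThan_Suc)
  also have "\<dots> = (\<Sum>i<Suc j. of_int (Omega (Suc j) i) * (1 / x ^ i) * normalized_Q (j - i) x)"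
    by (rule sum.cong) (simp_all only: pow lessThan_iff mult.assoc)
  finally show ?thesis .
qed

lemma Delta_eq_choose_mult_normalized_Q:
  assumes "x \<noteq> 0"
  shows "Delta n k x = real (n choose k) * normalized_Q k x"
proof (induction n arbitrary: k rule: less_induct)
  case (less n)
  consider "k = 0" | "n < k" | m j where "n = Suc m" "k = Suc j" "j \<le> m"
    by (cases n; cases k) force+
  then show ?case
  proof cases
    case 1
    then show ?thesis using assms by (simp add: Delta.simps[of _ 0] normalized_Q_0)
  next
    case 2
    then show ?thesis by (simp add: Delta.simps[of n])
  next
    case 3
    have term_eq: "of_int (Omega n i) * (1 / x ^ i) * Delta (m - i) (j - i) x
        = real (m choose j) * (of_int (Omega (Suc j) i) * (1 / x ^ i) * normalized_Q (j - i) x)"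
      if "i < Suc j" for i
    proof -
      have "of_int (Omega n i) * real ((m - i) choose (j - i))
          = real (m choose j) * of_int (Omega (Suc j) i)"
        using Omega_mult_choose[of i j m] 3 that
        by (metis less_Suc_eq_le of_int_mult of_int_of_nat_eq)
      moreover have "Delta (m - i) (j - i) x = real ((m - i) choose (j - i)) * normalized_Q (j - i) x"
        using less.IH 3 by simp
      ultimately show ?thesis by (simp add: mult_ac)
    qed
    have "Delta n k x = Delta m k x
        + (\<Sum>i<Suc j. of_int (Omega n i) * (1 / x ^ i) * Delta (m - i) (j - i) x)"
      using 3 by (simp add: Delta.simps[of "Suc m"] del: sum.lessThan_Suc)
    also have "\<dots> = Delta m k x
        + (\<Sum>i<Suc j. real (m choose j)
            * (of_int (Omega (Suc j) i) * (1 / x ^ i) * normalized_Q (j - i) x))"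
      by (intro arg_cong2[where f = "(+)"] refl sum.cong) (simp_all only: term_eq lessThan_iff)
    also have "\<dots> = real (m choose k) * normalized_Q k x + real (m choose j) * normalized_Q k x"
      using less.IH[of m k] 3 normalized_Q_Suc[OF assms, of j] by (simp only: sum_distrib_left)
    also have "\<dots> = real (n choose k) * normalized_Q k x"
      using 3 by (simp add: algebra_simps)
    finally show ?thesis .
  qed
qed

theorem proposition4p12:
  fixes n k :: nat and x :: real
  assumes "x > 0"
  shows "Delta n k x = real (n choose k) * (Q k x / x powi (int k - 1))"
  using Delta_eq_choose_mult_normalized_Q[of x n k] assms by (simp add: normalized_Q_def)

end
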